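(* For every $m\ge0$, $$\nu_2\bigl([Z^{-(2m+2)}]\,\mathsf F\bigr)=2-2m+s_2(m).$$
   Context: Let $B_{2j}$ be the Bernoulli numbers, $\mathsf G_{2j}=2(1-2^{2j})B_{2j}$ (Genocchi numbers), $b_j=\dfrac{2^{2j-1}\mathsf G_{2j}}{(2j)(2j-1)}$ for $j\ge1$, and $\mathsf B(Z)=\sum_{j\ge1}b_j(Z-1)^{1-2j}$. Define the formal power series in $Z^{-1}$ with rational coefficients $$\mathsf F(Z)=-\frac{4Z\,e^{\mathsf B(Z)}}{(Z-1)^2(Z+1)}$$ (all powers of $(Z\pm1)^{-1}$ being expanded at $Z=\infty$). $[Z^{-n}]$ is coefficient extraction, $\nu_2$ is the $2$-adic valuation on $\mathbb Q$, and $s_2(m)$ is the sum of the binary digits of $m$. *)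

theory Defs
  imports
    "HOL-Computational_Algebra.Computational_Algebra"
    "HOL-Library.Extended"
begin

text \<open>Bernoulli numbers, normalised by \<open>t / (e\<^sup>t - 1) = (\<Sum>n. B\<^sub>n t\<^sup>n / n!)\<close>.\<close>

definition bernoulli :: "nat \<Rightarrow> rat" where
  "bernoulli n = fact n * fps_nth (fps_X / (fps_exp 1 - 1)) n"

definition genocchi_even :: "nat \<Rightarrow> rat" where
  "genocchi_even j = 2 * (1 - 2 ^ (2 * j)) * bernoulli (2 * j)"

definition b_coeff :: "nat \<Rightarrow> rat" where
  "b_coeff j = 2 ^ (2 * j - 1) * genocchi_even j / (of_nat (2 * j) * of_nat (2 * j - 1))"

text \<open>
  Series in \<open>Z\<^sup>-\<^sup>1\<close> are Laurent series in the formal variable \<open>X = Z\<^sup>-\<^sup>1\<close>, so that \<open>Z\<close> itself is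
  \<^const>\<open>fls_X_inv\<close> and division in the field \<^typ>\<open>rat fls\<close> is expansion at \<open>Z = \<infinity>\<close>.
\<close>

abbreviation Z :: "rat fls" where
  "Z \<equiv> fls_X_inv"

definition inv_Z_minus_1 :: "rat fps" where
  "inv_Z_minus_1 = fps_X / (1 - fps_X)"

text \<open>
  \<open>\<Sum>j\<ge>1. b\<^sub>j T\<^sup>2\<^sup>j\<^sup>-\<^sup>1\<close> with \<open>(Z - 1)\<^sup>-\<^sup>1\<close> substituted for \<open>T\<close>; the lemma \<open>B_series_nth\<close> below
  identifies the result with \<open>\<Sum>j\<ge>1. b\<^sub>j (Z - 1)\<^bsup>1 - 2j\<^esup>\<close>.
\<close>

definition B_series :: "rat fps" where
  "B_series = fps_compose (Abs_fps (\<lambda>n. if odd n then b_coeff ((n + 1) div 2) else 0)) inv_Z_minus_1"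

definition F_series :: "rat fls" where
  "F_series =
     - (4 * Z * fps_to_fls (fps_compose (fps_exp 1) B_series) / ((Z - 1) ^ 2 * (Z + 1)))"

text \<open>The 2-adic valuation on the rationals, with value \<open>\<infinity>\<close> at \<open>0\<close>.\<close>

definition nu2 :: "rat \<Rightarrow> int extended" where
  "nu2 q =
     (if q = 0 then Pinf
      else Fin (int (multiplicity 2 (fst (quotient_of q))) -
                int (multiplicity 2 (snd (quotient_of q)))))"

fun binary_digit_sum :: "nat \<Rightarrow> nat" where
  "binary_digit_sum m = (if m = 0 then 0 else m mod 2 + binary_digit_sum (m div 2))"

declare binary_digit_sum.simps [simp del]

lemma fps_to_fls_inv_Z_minus_1: "fps_to_fls inv_Z_minus_1 = inverse (Z - 1)"
proof -
  have "inv_Z_minus_1 * (1 - fps_X) = fps_X"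
    by (simp add: inv_Z_minus_1_def fps_divide_unit mult.assoc inverse_mult_eq_1)
  then have *: "fps_to_fls inv_Z_minus_1 * (1 - fls_X) = fls_X"
    by (metis fls_times_fps_to_fls fps_to_fls_minus fps_one_to_fls fps_X_to_fls)
  have gen: "a = inverse (inverse x - 1)" if "a * (1 - x) = x" "x \<noteq> 0" for a x :: "rat fls"
  proof -
    have "a * (inverse x - 1) = inverse x * (a * (1 - x))"
      using that(2) by (simp add: field_simps)
    then have "(inverse x - 1) * a = 1"
      using that by (simp add: mult.commute)
    then show ?thesis
      using inverse_unique by metis
  qed
  show ?thesis
    using gen[OF *] by (simp add: fls_inverse_X)
qed

text \<open>
  Since \<open>(Z - 1)\<^bsup>1 - 2j\<^esup>\<close> has order \<open>2j - 1 \<ge> j\<close> in \<open>X\<close>, only the terms with \<open>j \<le> n\<close> contribute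
  to the coefficient of \<open>X\<^sup>n\<close>.
\<close>

lemma B_series_nth:
  "fps_nth B_series n =
     (\<Sum>j=1..n. b_coeff j * fls_nth ((Z - 1) powi (1 - 2 * int j)) (int n))"
proof -
  have pw: "fls_nth ((Z - 1) powi (1 - 2 * int j)) (int n) = fps_nth (inv_Z_minus_1 ^ (2 * j - 1)) n"
    if "j \<ge> 1" for j
  proof -
    have e: "1 - 2 * int j = - int (2 * j - 1)"
      using that by simp
    have "(Z - 1) powi (1 - 2 * int j) = fps_to_fls (inv_Z_minus_1 ^ (2 * j - 1))"
      unfolding e power_int_minus power_int_of_nat
      by (simp add: fps_to_fls_power fps_to_fls_inv_Z_minus_1 power_inverse)
    then show ?thesis by simp
  qed
  have ord: "fps_nth (inv_Z_minus_1 ^ k) n = 0" if "k > n" for k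
  proof -
    have "fps_nth inv_Z_minus_1 0 = 0"
      by (simp add: inv_Z_minus_1_def fps_divide_unit)
    then show ?thesis using that by (simp add: startsby_zero_power_prefix)
  qed
  let ?g = "\<lambda>k. (if odd k then b_coeff ((k + 1) div 2) else 0) * fps_nth (inv_Z_minus_1 ^ k) n"
  have "fps_nth B_series n = (\<Sum>k=0..n. ?g k)"
    by (simp add: B_series_def fps_compose_nth)
  also have "\<dots> = (\<Sum>k\<in>(\<lambda>j. 2 * j - 1) ` {1..n}. ?g k)"
  proof (rule sum.mono_neutral_cong)
    fix k assume k: "k \<in> {0..n} - (\<lambda>j. 2 * j - 1) ` {1..n}"
    have "even k"
    proof (rule ccontr)
      assume "odd k"
      then obtain i where "k = 2 * i + 1" by (elim oddE)
      then have "k = 2 * (i + 1) - 1" "i + 1 \<in> {1..n}" using k by auto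
      then show False using k by blast
    qed
    then show "?g k = 0" by simp
  next
    fix k assume "k \<in> (\<lambda>j. 2 * j - 1) ` {1..n} - {0..n}"
    then show "?g k = 0" using ord by auto
  qed auto
  also have "\<dots> = (\<Sum>j=1..n. ?g (2 * j - 1))"
    by (subst sum.reindex) (auto simp: inj_on_def)
  also have "\<dots> = (\<Sum>j=1..n. b_coeff j * fls_nth ((Z - 1) powi (1 - 2 * int j)) (int n))"
    by (rule sum.cong) (auto simp: pw)
  finally show ?thesis .
qed

end

theory Submission
  imports Defs
begin

text \<open>
  Put \<open>E(Z) = e\<^bsup>B(Z)\<^esup>\<close>. The numbers \<open>b\<^sub>j\<close> are made so that \<open>B\<close> is, in Stirling's asymptotic sense, the
  logarithm of a quotient of Gamma functions:
  \<open>E(Z) \<sim> (\<Gamma>(x) / \<Gamma>(x - 1/2))\<^sup>2 / (x - 1/2)\<close> with \<open>x = (Z + 1)/4\<close>. By the recursion of the Gamma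
  function this equals \<open>(x - 1/2) (\<Gamma>(x) / \<Gamma>(x + 1/2))\<^sup>2\<close>, and Gauss's summation theorem for
  \<open>\<^sub>2F\<^sub>1(1/2, 1/2; x + 1; 1)\<close> turns it into the expansion
  \<open>E(Z) = (Z - 1) (\<Sum>n\<ge>0. ((2n - 1)!!)\<^sup>2 / (n! (Z + 1) (Z + 5) \<cdots> (Z + 4n + 1)))\<close>.
  Hence, up to the factor \<open>- 4\<close>, the series \<open>F\<close> is the sum of the series
  \<open>((2n - 1)!!)\<^sup>2 / n! \<cdot> Z / ((Z\<^sup>2 - 1) (Z + 1) \<cdots> (Z + 4n + 1))\<close>. Apart from the rational prefactor, each
  of them has integer coefficients and the leading term \<open>Z\<^bsup>-n-2\<^esup>\<close>. So only \<open>n \<le> 2m\<close> contributes to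
  the coefficient of \<open>Z\<^bsup>-2m-2\<^esup>\<close>. The term \<open>n = 2m\<close> contributes a rational number of valuation
  \<open>- \<nu>\<^sub>2((2m)!)\<close>, and all others have a strictly larger valuation, because \<open>2m\<close> is even
  (\<open>fact_mult_F_series_nth\<close>). By Legendre's formula, \<open>\<nu>\<^sub>2((2m)!) = 2m - s\<^sub>2(m)\<close>.

  The expansion is proved on formal power series in \<open>X = 1/Z\<close>, without Gamma functions. The derivative
  of the exponent is the formal Laplace transform of \<open>tanh\<close> (\<open>X_power2_mult_deriv_beta\<close>), and
  \<open>(1 + e\<^bsup>-2t\<^esup>) tanh t = 1 - e\<^bsup>-2t\<^esup>\<close> yields \<open>E(Z) E(Z + 2) = (Z - 1)/(Z + 1)\<close>, hence a linear difference
  equation that links \<open>E(Z + 4)\<close> to \<open>E(Z)\<close> (\<open>exp_B_shift\<close>). The partial sums of the hypergeometric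
  series satisfy the same equation up to an explicit error of high order, by telescoping
  (\<open>gauss_term_telescopes\<close>). Solutions of the equation are unique up to a constant factor, since a
  nonconstant power series in \<open>1/Z\<close> is never invariant under a translation
  (\<open>nth_eq_0_if_translate_invariant\<close>); so the two sides agree to that order (\<open>exp_B_nth_eq\<close>).
\<close>

section \<open>Translation of the variable\<close>

text \<open>In the variable \<open>X = 1/Z\<close> this is \<open>(Z + c)/Z\<close>, the polynomial stand-in for \<open>Z + c\<close>.\<close>

definition lin :: "'a::field_char_0 \<Rightarrow> 'a fps" where
  "lin c = 1 + fps_const c * fps_X"

text \<open>
  The substitution \<open>Z \<mapsto> Z + a\<close>: from \<open>X = 1/Z\<close> it follows that \<open>1/(Z + a) = X/(1 + a X)\<close>.
\<close>

definition translate :: "'a::field_char_0 \<Rightarrow> 'a fps \<Rightarrow> 'a fps" where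
  "translate a f = f oo (fps_X * inverse (lin a))"

lemma lin_nth_0 [simp]: "lin c $ 0 = 1"
  by (simp add: lin_def)

lemma lin_neq_0 [simp]: "lin c \<noteq> 0"
  by (metis lin_nth_0 fps_zero_nth zero_neq_one)

lemma inverse_lin_mult [simp]: "inverse (lin c) * lin c = 1" "lin c * inverse (lin c) = 1"
  by (simp_all add: inverse_mult_eq_1 inverse_mult_eq_1')

lemma translate_mult: "translate a (f * g) = translate a f * translate a g"
  and translate_add: "translate a (f + g) = translate a f + translate a g"
  and translate_const [simp]: "translate a (fps_const c) = fps_const c"
  and translate_1 [simp]: "translate a 1 = 1"
  and translate_X: "translate a fps_X = fps_X * inverse (lin a)"
  and translate_nth_0 [simp]: "translate a f $ 0 = f $ 0"
  unfolding translate_def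
  by (simp_all add: fps_compose_mult_distrib fps_compose_add_distrib)

lemma translate_sum: "translate a (sum f A) = (\<Sum>x\<in>A. translate a (f x))"
  by (simp add: translate_def fps_compose_sum_distrib)

lemma translate_inverse: "f $ 0 \<noteq> 0 \<Longrightarrow> translate a (inverse f) = inverse (translate a f)"
  by (simp add: translate_def fps_inverse_compose)

lemma translate_lin: "translate a (lin c) = lin (c + a) * inverse (lin a)"
proof -
  have "translate a (lin c) = lin a * inverse (lin a) + fps_const c * (fps_X * inverse (lin a))"
    by (simp add: lin_def[of c] translate_add translate_mult translate_X)
  also have "\<dots> = lin (c + a) * inverse (lin a)"
    by (simp add: lin_def algebra_simps flip: fps_const_add)
  finally show ?thesis .
qed

lemma translate_translate: "translate a (translate b f) = translate (a + b) f"
proof -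
  have "translate a (translate b f) = f oo translate a (fps_X * inverse (lin b))"
    by (simp add: translate_def fps_compose_assoc)
  also have "translate a (fps_X * inverse (lin b)) = fps_X * inverse (lin (a + b))"
  proof -
    have "fps_X * inverse (lin a) * (inverse (lin (a + b)) * inverse (inverse (lin a)))
       = fps_X * inverse (lin (a + b)) * (inverse (lin a) * inverse (inverse (lin a)))"
      by (simp only: mult_ac)
    then show ?thesis
      by (simp add: translate_mult translate_X translate_inverse translate_lin fps_inverse_mult
        add.commute)
  qed
  finally show ?thesis by (simp add: translate_def)
qed

text \<open>
  The coefficients of \<open>(Z + a)\<^bsup>-j-1\<^esup>\<close> are those of a negative binomial series. There are two uses:
  the translation rule for the Laplace transform, and the fact that the lowest term of a series
  changes under translation.
\<close>

lemma translate_nth: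
  "translate a f $ Suc n = (\<Sum>j\<le>n. f $ Suc j * (of_nat (n choose j) * (- a) ^ (n - j)))"
proof -
  have pw: "(fps_X * inverse (lin a)) ^ Suc j $ Suc n = of_nat (n choose j) * (- a) ^ (n - j)"
    if "j \<le> n" for j
  proof -
    have "lin a = 1 - fps_const (- a) * fps_X"
      by (simp add: lin_def flip: fps_const_neg)
    then have "inverse (lin a) ^ Suc j = inverse ((1 - fps_const (- a) * fps_X) ^ Suc j)"
      by (simp only: fps_inverse_power)
    then have "(fps_X * inverse (lin a)) ^ Suc j =
      fps_X ^ Suc j * Abs_fps (\<lambda>k. of_nat ((Suc j + k - 1) choose k) * (- a) ^ k)"
      unfolding power_mult_distrib by (subst (asm) one_minus_const_fps_X_neg_power') simp_all
    then have "(fps_X * inverse (lin a)) ^ Suc j $ Suc n =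
      of_nat (n choose (n - j)) * (- a) ^ (n - j)"
      using that by (simp add: fps_X_power_mult_nth del: power_Suc)
    then show ?thesis using that by (simp add: binomial_symmetric[OF that])
  qed
  have "translate a f $ Suc n = (\<Sum>i\<le>Suc n. f $ i * (fps_X * inverse (lin a)) ^ i $ Suc n)"
    by (simp add: translate_def fps_compose_nth atMost_atLeast0 del: power_Suc)
  also have "\<dots> = (\<Sum>j\<le>n. f $ Suc j * (fps_X * inverse (lin a)) ^ Suc j $ Suc n)"
    by (subst sum.atMost_Suc_shift) (simp del: power_Suc)
  finally show ?thesis by (simp add: pw del: power_Suc)
qed

text \<open>
  If \<open>c X\<^sup>k\<close> with \<open>k \<ge> 1\<close> is the lowest nonconstant term of \<open>f\<close>, then translation by \<open>a\<close> changes the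
  coefficient of \<open>X\<^bsup>k+1\<^esup>\<close> by \<open>- a k c\<close>. Hence a series that is invariant up to a certain order is
  constant up to one order less; this is the uniqueness principle for homogeneous linear
  difference equations of first order.
\<close>

lemma nth_eq_0_if_translate_invariant:
  assumes a: "a \<noteq> 0" and f: "\<And>k. k \<le> Suc n \<Longrightarrow> translate a f $ k = f $ k"
    and k: "1 \<le> k" "k \<le> n"
  shows "f $ k = 0"
  using k
proof (induction k rule: less_induct)
  case (less k)
  then obtain i where i: "k = Suc i" by (cases k) auto
  \<comment> \<open>By the induction hypothesis, only the terms of index \<open>k\<close> and \<open>k + 1\<close> contribute.\<close>
  have "f $ Suc k = translate a f $ Suc k" using f less.prems by simp
  also have "\<dots> = (\<Sum>j\<in>{i, k}. f $ Suc j * (of_nat (k choose j) * (- a) ^ (k - j)))"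
    unfolding translate_nth using less i by (intro sum.mono_neutral_right) auto
  also have "\<dots> = - f $ k * of_nat k * a + f $ Suc k"
    using i by simp
  finally show ?case using a i by (auto simp del: of_nat_Suc)
qed

section \<open>The formal Laplace transform\<close>

text \<open>Termwise \<open>\<integral>\<^sub>0\<^sup>\<infinity> t\<^sup>n e\<^bsup>-Z t\<^esup> dt = n! Z\<^bsup>-n-1\<^esup>\<close>.\<close>

definition laplace :: "'a::field_char_0 fps \<Rightarrow> 'a fps" where
  "laplace f = Abs_fps (\<lambda>n. case n of 0 \<Rightarrow> 0 | Suc k \<Rightarrow> fact k * f $ k)"

lemma laplace_nth [simp]: "laplace f $ 0 = 0" "laplace f $ Suc n = fact n * f $ n"
  by (simp_all add: laplace_def)

lemma laplace_add: "laplace (f + g) = laplace f + laplace g"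
  and laplace_diff: "laplace (f - g) = laplace f - laplace g"
  by (simp_all add: fps_eq_iff laplace_def algebra_simps split: nat.split)

lemma laplace_1: "laplace 1 = fps_X"
  by (auto simp add: fps_eq_iff laplace_def split: nat.split)

text \<open>
  Under the integral \<open>\<integral> f(t) e\<^bsup>-Z t\<^esup> dt\<close>, the factor \<open>e\<^bsup>-a t\<^esup>\<close> replaces \<open>Z\<close> by \<open>Z + a\<close>. Formally, the
  factorials turn the convolution on the left into the binomial sum that describes the
  translation.
\<close>

lemma laplace_exp_mult: "laplace (fps_exp (- a) * f) = translate a (laplace f)"
proof (rule fps_ext)
  fix n
  show "laplace (fps_exp (- a) * f) $ n = translate a (laplace f) $ n"
  proof (cases n)
    case (Suc k)
    have "fact k * (fps_exp (- a) * f) $ k =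
      (\<Sum>j\<le>k. fact k * (f $ j * ((- a) ^ (k - j) / fact (k - j))))"
      by (subst mult.commute[of "fps_exp _"])
        (simp add: fps_mult_nth atMost_atLeast0 sum_distrib_left)
    also have "\<dots> = (\<Sum>j\<le>k. fact j * f $ j * (of_nat (k choose j) * (- a) ^ (k - j)))"
      by (rule sum.cong) (simp_all add: binomial_fact field_simps)
    finally show ?thesis by (simp add: Suc translate_nth)
  qed simp
qed

section \<open>Bernoulli numbers and the hyperbolic tangent\<close>

definition bern_egf :: "rat fps" where
  "bern_egf = fps_X / (fps_exp 1 - 1)"

lemma bern_egf_mult: "bern_egf * (fps_exp 1 - 1) = fps_X"
proof -
  have ne: "fps_exp 1 - 1 \<noteq> (0 :: rat fps)" by simp
  have "subdegree (fps_exp 1 - 1 :: rat fps) = 1"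
    by (rule subdegreeI) auto
  with ne have "(fps_exp 1 - 1 :: rat fps) dvd fps_X"
    by (simp add: fps_dvd_iff)
  then show ?thesis by (simp add: bern_egf_def)
qed

lemma bern_egf_scaled:
  "(bern_egf oo (fps_const c * fps_X)) * (fps_exp c - 1) = fps_const c * fps_X"
proof -
  have "(bern_egf * (fps_exp 1 - 1)) oo (fps_const c * fps_X) = fps_const c * fps_X"
    by (simp add: bern_egf_mult)
  then show ?thesis
    by (simp add: fps_compose_mult_distrib fps_compose_sub_distrib)
qed

text \<open>\<open>H(t) = t/(e\<^sup>t - 1)\<close> satisfies \<open>H(-t) - H(t) = t\<close>.\<close>

lemma bern_egf_nth_odd:
  assumes "odd n"
  shows "bern_egf $ n = (if n = 1 then - 1 / 2 else 0)"
proof -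
  define H' where "H' = bern_egf oo (fps_const (- 1) * fps_X)"
  have inv: "fps_exp (- 1) * fps_exp 1 = (1 :: rat fps)"
    using fps_exp_add_mult[of "- 1" "1 :: rat"] by simp
  have "H' * (fps_exp (- 1) - 1) = - fps_X"
    unfolding H'_def by (subst bern_egf_scaled) (simp flip: fps_const_neg)
  then have "H' * (fps_exp (- 1) - 1) * fps_exp 1 = - fps_X * fps_exp 1" by simp
  then have "H' * (fps_exp (- 1) * fps_exp 1) - H' * fps_exp 1 = - (fps_X * fps_exp 1)"
    by (simp only: left_diff_distrib right_diff_distrib mult_1_right mult_1_left mult.assoc
      mult_minus_left)
  then have "H' * (fps_exp 1 - 1) = fps_X * fps_exp 1"
    unfolding inv by (simp add: right_diff_distrib) (metis minus_diff_eq minus_equation_iff)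
  then have "(H' - bern_egf - fps_X) * (fps_exp 1 - 1) = 0"
    using bern_egf_mult by (simp add: algebra_simps)
  then have "H' - bern_egf - fps_X = 0" by simp
  then have "(H' - bern_egf - fps_X) $ n = 0" by simp
  then show ?thesis using assms by (auto simp: H'_def fps_X_nth)
qed

definition tanh_series :: "rat fps" where
  "tanh_series = (fps_exp 2 - 1) * inverse (fps_exp 2 + 1)"

lemma tanh_series_mult: "(fps_exp 2 + 1) * tanh_series = fps_exp 2 - 1"
proof -
  have "(fps_exp 2 + 1 :: rat fps) * inverse (fps_exp 2 + 1) = 1"
    by (rule inverse_mult_eq_1') simp
  then show ?thesis unfolding tanh_series_def by (simp add: mult.left_commute)
qed

text \<open>
  This is the identity \<open>t tanh t = H(4t) - H(2t) + t\<close> with \<open>H(t) = t/(e\<^sup>t - 1)\<close>; it follows on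
  multiplication by \<open>q\<^sup>2 - 1\<close>, where \<open>q = e\<^bsup>2t\<^esup>\<close>.
\<close>

lemma tanh_series_nth:
  "tanh_series $ n = (4 ^ Suc n - 2 ^ Suc n) * bern_egf $ Suc n + (if n = 0 then 1 else 0)"
proof -
  define H where "H c = bern_egf oo (fps_const c * fps_X)" for c
  define q where "q = (fps_exp 2 :: rat fps)"
  have q2: "fps_exp 4 = q * q"
    using fps_exp_add_mult[of 2 "2::rat"] by (simp add: q_def)
  have H: "H 4 * (q * q - 1) = 4 * fps_X" "H 2 * (q - 1) = 2 * fps_X"
    using bern_egf_scaled[of 4] bern_egf_scaled[of 2]
    by (simp_all add: H_def q_def[symmetric] q2 numeral_fps_const)
  have t: "(q + 1) * tanh_series = q - 1"
    using tanh_series_mult by (simp add: q_def)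
  have "(fps_X * tanh_series - (H 4 - H 2 + fps_X)) * (q * q - 1) =
     fps_X * (q - 1) * ((q + 1) * tanh_series) - H 4 * (q * q - 1) + H 2 * (q - 1) * (q + 1)
       - fps_X * (q * q - 1)"
    by (simp add: algebra_simps)
  also have "\<dots> = 0"
    unfolding H t by (simp add: algebra_simps)
  finally have "(fps_X * tanh_series - (H 4 - H 2 + fps_X)) * (q * q - 1) = 0" .
  moreover have "q * q - 1 \<noteq> 0" by (simp flip: q2)
  ultimately have "fps_X * tanh_series = H 4 - H 2 + fps_X" by simp
  then have "(fps_X * tanh_series) $ Suc n = (H 4 - H 2 + fps_X) $ Suc n" by simp
  then show ?thesis by (simp add: H_def fps_X_nth left_diff_distrib)
qed

section \<open>The difference equation of the exponential series\<close>

text \<open>The series \<open>\<Sum>j\<ge>1. b\<^sub>j T\<^sup>2\<^sup>j\<^sup>-\<^sup>1\<close>, with \<open>T = 1/w\<close> and \<open>w = Z - 1\<close>.\<close>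

definition beta_series :: "rat fps" where
  "beta_series = Abs_fps (\<lambda>n. if odd n then b_coeff ((n + 1) div 2) else 0)"

text \<open>
  Since \<open>d/dw = - T\<^sup>2 d/dT\<close>, this says that the derivative of the exponent with respect to \<open>w\<close> is the
  Laplace transform of \<open>tanh\<close>. The factor \<open>4\<^sup>k - 2\<^sup>k\<close> in the coefficients of \<open>tanh\<close> is, up to sign,
  the combination of powers of two in \<open>b\<^sub>j\<close>, with \<open>k = 2j\<close>.
\<close>

lemma X_power2_mult_deriv_beta: "fps_X\<^sup>2 * fps_deriv beta_series = - laplace tanh_series"
proof (rule fps_ext)
  fix n
  have b: "bern_egf $ k = bernoulli k / fact k" for k
    by (simp add: bernoulli_def bern_egf_def)
  consider "n = 0" | "n = 1" | k where "n = Suc (Suc k)"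
    by (metis One_nat_def not0_implies_Suc)
  then show "(fps_X\<^sup>2 * fps_deriv beta_series) $ n = (- laplace tanh_series) $ n"
  proof cases
    case 3
    show ?thesis
    proof (cases "even k")
      case True
      then obtain i where i: "k = 2 * i" by (elim evenE)
      define P B x y :: rat
        where "P = 2 ^ (2 * i)" and "B = bernoulli (2 * i + 2)"
          and "x = of_nat (2 * i + 1)" and "y = of_nat (2 * i + 2)"
      have ne: "x \<noteq> 0" "y \<noteq> 0"
        unfolding x_def y_def of_nat_eq_0_iff by simp_all
      have "(4 :: rat) ^ (2 * i) = P * P"
        by (simp add: P_def flip: power_mult_distrib)
      then have "tanh_series $ Suc k = (16 * (P * P) - 4 * P) * (B / fact (2 * i + 2))"
        by (simp add: i tanh_series_nth b P_def B_def)
      moreover have "fact (2 * i + 2) = y * fact (2 * i + 1)"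
        by (simp add: y_def)
      ultimately have R: "fact (Suc k) * tanh_series $ Suc k = (16 * (P * P) - 4 * P) * (B / y)"
        by (simp add: i del: fact_Suc)
      have "b_coeff (i + 1) = 4 * P * (1 - 4 * P) * B / (y * x)"
        by (simp add: b_coeff_def genocchi_even_def P_def B_def x_def y_def)
      then have "x * b_coeff (i + 1) = 4 * P * (1 - 4 * P) * (B / y)"
        using ne by simp
      moreover have "fps_deriv beta_series $ k = x * b_coeff (i + 1)"
        by (simp add: beta_series_def i x_def)
      ultimately have "fps_deriv beta_series $ k = - (fact (Suc k) * tanh_series $ Suc k)"
        unfolding R by (simp add: algebra_simps)
      then show ?thesis
        by (simp add: 3 fps_X_power_mult_nth del: fact_Suc fps_deriv_nth)
    next
      case False
      then show ?thesis
        by (simp add: 3 fps_X_power_mult_nth beta_series_def tanh_series_nth bern_egf_nth_odd)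
    qed
  qed (simp_all add: fps_X_power_mult_nth tanh_series_nth bern_egf_nth_odd)
qed

text \<open>
  The transform of \<open>(1 + e\<^bsup>-2t\<^esup>) tanh t = 1 - e\<^bsup>-2t\<^esup>\<close>; the right-hand side is \<open>1/w - 1/(w + 2)\<close>.
\<close>

lemma laplace_tanh_shift:
  "laplace tanh_series + translate 2 (laplace tanh_series) = fps_X - fps_X * inverse (lin 2)"
proof -
  have inv: "fps_exp (- 2) * fps_exp 2 = (1 :: rat fps)"
    using fps_exp_add_mult[of "- 2" "2 :: rat"] by simp
  have "fps_exp (- 2) * ((fps_exp 2 + 1) * tanh_series) = fps_exp (- 2) * (fps_exp 2 - 1)"
    by (simp add: tanh_series_mult)
  then have "(fps_exp (- 2) * fps_exp 2) * tanh_series + fps_exp (- 2) * tanh_series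
      = fps_exp (- 2) * fps_exp 2 - fps_exp (- 2)"
    by (simp only: left_diff_distrib right_diff_distrib distrib_left distrib_right
      mult_1_right mult_1_left mult.assoc)
  then have "tanh_series + fps_exp (- 2) * tanh_series = 1 - fps_exp (- 2) * 1"
    by (simp only: inv mult_1_left mult_1_right)
  then have "laplace (tanh_series + fps_exp (- 2) * tanh_series) = laplace (1 - fps_exp (- 2) * 1)"
    by simp
  then show ?thesis
    by (simp only: laplace_add laplace_diff laplace_exp_mult laplace_1 translate_X)
qed

text \<open>Translations commute with \<open>d/dZ = - X\<^sup>2 d/dX\<close>.\<close>

lemma deriv_translate:
  "fps_X\<^sup>2 * fps_deriv (translate a f) = translate a (fps_X\<^sup>2 * fps_deriv f)"
proof -
  define M where "M = fps_X * inverse (lin a)"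
  have "M * lin a = fps_X" by (simp add: M_def mult.assoc)
  then have "fps_deriv (M * lin a) = 1" by simp
  then have "fps_deriv M * lin a + M * fps_const a = 1"
    by (simp add: lin_def algebra_simps)
  then have "lin a * (fps_deriv M * lin a + M * fps_const a) = lin a" by simp
  then have "fps_deriv M * (lin a)\<^sup>2 = lin a - fps_const a * (M * lin a)"
    by (simp add: algebra_simps power2_eq_square)
  also have "\<dots> = 1" using \<open>M * lin a = fps_X\<close> by (simp add: lin_def)
  finally have M': "fps_deriv M * (lin a)\<^sup>2 = 1" .
  have "fps_X\<^sup>2 * fps_deriv M = M\<^sup>2 * (fps_deriv M * (lin a)\<^sup>2)"
    unfolding \<open>M * lin a = fps_X\<close>[symmetric] by (simp add: algebra_simps power_mult_distrib)
  then have X: "fps_X\<^sup>2 * fps_deriv M = M\<^sup>2" by (simp add: M')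
  have "fps_X\<^sup>2 * fps_deriv (translate a f) = translate a (fps_deriv f) * (fps_X\<^sup>2 * fps_deriv M)"
    by (simp add: translate_def M_def fps_compose_deriv)
  then show ?thesis
    unfolding X by (simp add: translate_mult power2_eq_square translate_X M_def)
qed

definition exp_beta :: "rat fps" where
  "exp_beta = fps_exp 1 oo beta_series"

text \<open>
  This is \<open>E(w) E(w + 2) = w/(w + 2)\<close> for \<open>E(w) = exp (\<Sum>j\<ge>1. b\<^sub>j w\<^bsup>1-2j\<^esup>)\<close>: by the previous lemmas both
  sides have the same logarithmic derivative, and both have constant term 1.
\<close>

lemma exp_beta_shift: "exp_beta * translate 2 exp_beta * lin 2 = 1"
proof -
  define V where "V = exp_beta * translate 2 exp_beta * lin 2"
  define L where "L = laplace tanh_series"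
  have beta0: "beta_series $ 0 = 0" by (simp add: beta_series_def)
  have dE: "fps_X\<^sup>2 * fps_deriv exp_beta = - L * exp_beta"
    unfolding L_def X_power2_mult_deriv_beta[symmetric]
    by (simp add: exp_beta_def fps_compose_deriv beta0 algebra_simps)
  have dTE: "fps_X\<^sup>2 * fps_deriv (translate 2 exp_beta) = - translate 2 L * translate 2 exp_beta"
    unfolding deriv_translate dE
    by (simp add: translate_mult translate_def fps_compose_uminus fps_compose_mult_distrib)
  have dlin: "fps_deriv (lin 2 :: rat fps) = 2"
    by (simp add: lin_def numeral_fps_const)
  have "fps_X\<^sup>2 * fps_deriv V =
      (fps_X\<^sup>2 * fps_deriv exp_beta) * translate 2 exp_beta * lin 2
      + exp_beta * (fps_X\<^sup>2 * fps_deriv (translate 2 exp_beta)) * lin 2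
      + exp_beta * translate 2 exp_beta * (2 * fps_X\<^sup>2)"
    unfolding V_def by (simp add: dlin algebra_simps)
  also have "\<dots> = exp_beta * translate 2 exp_beta * (2 * fps_X\<^sup>2 - (L + translate 2 L) * lin 2)"
    unfolding dE dTE by (simp add: algebra_simps)
  also have "(L + translate 2 L) * lin 2 = fps_X * lin 2 - fps_X * (inverse (lin 2) * lin 2)"
    unfolding L_def laplace_tanh_shift by (simp only: left_diff_distrib mult.assoc)
  also have "\<dots> = 2 * fps_X\<^sup>2"
    unfolding inverse_lin_mult by (simp add: lin_def algebra_simps power2_eq_square numeral_fps_const)
  finally have "fps_deriv V = 0" by simp
  then have "V = fps_const (V $ 0)" by simp
  also have "V $ 0 = 1" by (simp add: V_def exp_beta_def)
  finally show ?thesis by (simp add: V_def)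
qed

definition exp_B :: "rat fps" where
  "exp_B = translate (- 1) exp_beta"

lemma exp_B_eq: "exp_B = fps_exp 1 oo B_series"
proof -
  have X: "inv_Z_minus_1 = fps_X * inverse (lin (- 1))"
    by (simp add: inv_Z_minus_1_def lin_def fps_divide_unit flip: fps_const_neg)
  have "(fps_exp 1 oo beta_series) oo inv_Z_minus_1 = fps_exp 1 oo (beta_series oo inv_Z_minus_1)"
    by (rule fps_compose_assoc[symmetric]) (simp_all add: X beta_series_def)
  then show ?thesis
    unfolding exp_B_def exp_beta_def B_series_def translate_def X beta_series_def .
qed

lemma exp_B_nth_0: "exp_B $ 0 = 1"
  by (simp add: exp_B_def exp_beta_def)

text \<open>With \<open>w = Z - 1\<close>, the equation becomes \<open>E(Z) E(Z + 2) = (Z - 1)/(Z + 1)\<close>.\<close>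

lemma exp_B_shift_2: "exp_B * translate 2 exp_B * lin 1 = lin (- 1)"
proof -
  have "translate (- 1) (exp_beta * translate 2 exp_beta * lin 2) = 1"
    by (simp add: exp_beta_shift)
  then have "exp_B * translate 2 exp_B * (lin 1 * inverse (lin (- 1))) = 1"
    by (simp add: translate_mult translate_translate translate_lin exp_B_def)
  then have "exp_B * translate 2 exp_B * (lin 1 * inverse (lin (- 1))) * lin (- 1) = lin (- 1)"
    by simp
  then show ?thesis
    by (simp only: mult.assoc inverse_lin_mult mult_1_right)
qed

text \<open>
  Applying the two-step equation twice gives \<open>E(Z + 4) / E(Z) = (Z + 1)\<^sup>2 / ((Z - 1) (Z + 3))\<close>. Unlike
  the two-step equation, this one is linear in \<open>E\<close>.
\<close>

lemma exp_B_shift: "lin (- 1) * lin 3 * translate 4 exp_B = (lin 1)\<^sup>2 * exp_B"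
proof -
  define E2 where "E2 = translate 2 exp_B"
  define E4 where "E4 = translate 4 exp_B"
  have "translate 2 (exp_B * E2 * lin 1) = translate 2 (lin (- 1))"
    by (simp add: E2_def exp_B_shift_2)
  then have "(E2 * E4 * lin 3) * inverse (lin 2) = lin 1 * inverse (lin 2)"
    by (simp add: E2_def E4_def translate_mult translate_translate translate_lin mult_ac)
  then have "E2 * E4 * lin 3 * inverse (lin 2) * lin 2 = lin 1 * inverse (lin 2) * lin 2" by simp
  then have 2: "E2 * E4 * lin 3 = lin 1"
    by (simp only: mult.assoc inverse_lin_mult mult_1_right)
  have "E2 \<noteq> 0"
    by (metis E2_def exp_B_nth_0 fps_zero_nth translate_nth_0 zero_neq_one)
  moreover have "E2 * (lin (- 1) * lin 3 * E4) = E2 * ((lin 1)\<^sup>2 * exp_B)"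
  proof -
    have "E2 * (lin (- 1) * lin 3 * E4) = lin (- 1) * (E2 * E4 * lin 3)" by (simp only: mult_ac)
    also have "\<dots> = (exp_B * E2 * lin 1) * lin 1" unfolding 2 by (simp add: E2_def exp_B_shift_2)
    finally show ?thesis by (simp only: mult_ac power2_eq_square)
  qed
  ultimately show ?thesis by (simp add: E4_def)
qed

section \<open>A hypergeometric expansion\<close>

text \<open>
  The terms \<open>a\<^sub>n Z / ((Z + 1) (Z + 5) \<cdots> (Z + 4n + 1))\<close> with \<open>a\<^sub>n = ((2n - 1)!!)\<^sup>2 / n!\<close>. Up to the factor
  \<open>Z/(Z + 1)\<close> they are the terms \<open>((1/2)\<^sub>n)\<^sup>2 / (n! (x + 1)\<^sub>n)\<close>, \<open>x = (Z + 1)/4\<close>, of the Gauss series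
  \<open>\<^sub>2F\<^sub>1(1/2, 1/2; x + 1; 1)\<close>.
\<close>

definition gauss_coeff :: "nat \<Rightarrow> rat" where
  "gauss_coeff n = (\<Prod>k<n. of_nat (2 * k + 1))\<^sup>2 / fact n"

definition gauss_term :: "nat \<Rightarrow> rat fps" where
  "gauss_term n = fps_const (gauss_coeff n) * fps_X ^ n * (\<Prod>k\<le>n. inverse (lin (of_nat (4 * k + 1))))"

definition gauss_sum :: "nat \<Rightarrow> rat fps" where
  "gauss_sum N = (\<Sum>n\<le>N. gauss_term n)"

lemma lin_of_nat: "lin (of_nat n) = 1 + of_nat n * fps_X"
  by (simp add: lin_def fps_of_nat)

lemma gauss_coeff_Suc: "gauss_coeff (Suc n) = gauss_coeff n * (of_nat ((2 * n + 1)\<^sup>2) / of_nat (n + 1))"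
  by (simp add: gauss_coeff_def power_mult_distrib)

lemma gauss_term_Suc:
  "gauss_term (Suc n) = gauss_term n * fps_const (of_nat ((2 * n + 1)\<^sup>2) / of_nat (n + 1)) * fps_X
     * inverse (lin (of_nat (4 * n + 5)))"
proof -
  have "4 * Suc n + 1 = 4 * n + 5" by simp
  then show ?thesis
    unfolding gauss_term_def gauss_coeff_Suc prod.atMost_Suc
    by (simp only: fps_const_mult[symmetric] power_Suc mult_ac)
qed

text \<open>
  The factors of the denominator form an arithmetic progression of difference 4. So translation by 4
  only replaces its first factor \<open>Z + 1\<close> by \<open>Z + 4n + 5\<close>, besides the numerator \<open>Z\<close> by \<open>Z + 4\<close>.
\<close>

lemma translate_gauss_term:
  "translate 4 (gauss_term n) * lin (of_nat (4 * n + 5)) = gauss_term n * lin 4 * lin 1"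
proof (induction n)
  case 0
  show ?case
    by (simp add: gauss_term_def gauss_coeff_def translate_mult translate_inverse translate_lin
      fps_inverse_mult mult_ac)
next
  case (Suc n)
  define r :: "rat fps" where "r = fps_const (of_nat ((2 * n + 1)\<^sup>2) / of_nat (n + 1))"
  define l l' :: "rat fps" where "l = lin (of_nat (4 * n + 5))" and "l' = lin (of_nat (4 * Suc n + 5))"
  have l: "l * inverse l = 1" and l': "inverse l' * l' = 1" and "l $ 0 \<noteq> 0" by (simp_all add: l_def l'_def)
  have T: "gauss_term (Suc n) = gauss_term n * r * fps_X * inverse l"
    by (simp add: gauss_term_Suc r_def l_def)
  have tl: "translate 4 l = l' * inverse (lin 4)"
    by (simp add: l_def l'_def translate_lin)
  have "translate 4 (gauss_term (Suc n)) =
     translate 4 (gauss_term n) * r * (fps_X * inverse (lin 4)) * inverse (l' * inverse (lin 4))"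
    using \<open>l $ 0 \<noteq> 0\<close> by (simp add: T translate_mult r_def translate_X translate_inverse tl)
  also have "\<dots> = translate 4 (gauss_term n) * r * fps_X * (inverse (lin 4) * lin 4) * inverse l'"
    by (simp add: fps_inverse_mult mult_ac)
  finally have "translate 4 (gauss_term (Suc n)) * l' = translate 4 (gauss_term n) * r * fps_X * (inverse l' * l')"
    unfolding inverse_lin_mult by (simp only: mult_ac mult_1_left mult_1_right)
  also have "\<dots> = (translate 4 (gauss_term n) * l) * inverse l * r * fps_X"
    unfolding l' using l by (simp add: mult_ac)
  also have "translate 4 (gauss_term n) * l = gauss_term n * lin 4 * lin 1"
    using Suc.IH by (simp add: l_def)
  also have "\<dots> * inverse l * r * fps_X = gauss_term (Suc n) * lin 4 * lin 1"
    unfolding T by (simp only: mult_ac)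
  finally show ?case by (simp add: l'_def)
qed

text \<open>
  The antidifference of Zeilberger's method for the recurrence
  \<open>(Z + 3)\<^sup>2 S(Z + 4) = (Z + 1)\<^sup>2 S(Z)\<close>, where \<open>S\<close> denotes the full series divided by \<open>Z\<close>.
\<close>

definition gauss_certificate :: "nat \<Rightarrow> rat fps" where
  "gauss_certificate n = 4 * of_nat n * fps_X * lin 1 * lin 4 * gauss_term n"

text \<open>
  On division by \<open>gauss_term n\<close> this is an identity between rational functions; cleared of the
  denominator \<open>l\<close>, it is the polynomial identity \<open>poly\<close> of the proof.
\<close>

lemma gauss_term_telescopes:
  "(lin 3)\<^sup>2 * translate 4 (gauss_term n) - (lin 1)\<^sup>2 * lin 4 * gauss_term n
     = gauss_certificate (Suc n) - gauss_certificate n"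
proof -
  define t l where "t = gauss_term n" and "l = (lin (of_nat (4 * n + 5)) :: rat fps)"
  have l: "inverse l * l = 1" and l0: "l \<noteq> 0" by (simp_all add: l_def)
  define r :: "rat fps" where "r = fps_const (of_nat ((2 * n + 1)\<^sup>2) / of_nat (n + 1))"
  have r: "r * of_nat (Suc n) = of_nat ((2 * n + 1)\<^sup>2)"
    unfolding r_def fps_of_nat[symmetric] fps_const_mult by simp
  have "gauss_certificate (Suc n) * l = 4 * (r * of_nat (Suc n)) * fps_X\<^sup>2 * lin 1 * lin 4 * t * (inverse l * l)"
    unfolding gauss_certificate_def gauss_term_Suc t_def[symmetric] l_def[symmetric] r_def[symmetric]
    by (simp only: mult_ac power2_eq_square)
  then have G: "gauss_certificate (Suc n) * l = 4 * of_nat ((2 * n + 1)\<^sup>2) * fps_X\<^sup>2 * lin 1 * lin 4 * t"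
    unfolding r l by simp
  have lins: "lin 1 = 1 + fps_X" "lin 3 = 1 + 3 * (fps_X :: rat fps)"
    by (simp_all add: lin_def numeral_fps_const)
  have poly: "(lin 3)\<^sup>2 - lin 1 * l = 4 * of_nat ((2 * n + 1)\<^sup>2) * fps_X\<^sup>2 - 4 * of_nat n * fps_X * l"
    unfolding l_def lin_of_nat lins by (simp add: algebra_simps power2_eq_square)
  have "((lin 3)\<^sup>2 * translate 4 t - (lin 1)\<^sup>2 * lin 4 * t) * l
     = (lin 3)\<^sup>2 * (translate 4 t * l) - (lin 1)\<^sup>2 * lin 4 * t * l"
    by (simp add: algebra_simps)
  also have "\<dots> = lin 1 * lin 4 * t * ((lin 3)\<^sup>2 - lin 1 * l)"
    unfolding t_def l_def translate_gauss_term by (simp add: algebra_simps power2_eq_square)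
  also have "\<dots> = gauss_certificate (Suc n) * l - gauss_certificate n * l"
    unfolding poly G by (simp add: gauss_certificate_def t_def algebra_simps)
  finally have "((lin 3)\<^sup>2 * translate 4 t - (lin 1)\<^sup>2 * lin 4 * t) * l = (gauss_certificate (Suc n) - gauss_certificate n) * l"
    by (simp add: left_diff_distrib)
  then show ?thesis using l0 by (simp add: t_def)
qed

lemma gauss_sum_shift:
  "(lin 3)\<^sup>2 * translate 4 (gauss_sum N) - (lin 1)\<^sup>2 * lin 4 * gauss_sum N = gauss_certificate (Suc N)"
proof -
  have "(lin 3)\<^sup>2 * translate 4 (gauss_sum N) - (lin 1)\<^sup>2 * lin 4 * gauss_sum N
     = (\<Sum>n<Suc N. gauss_certificate (Suc n) - gauss_certificate n)"
    by (simp add: gauss_sum_def translate_sum sum_distrib_left sum_subtractf[symmetric]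
      gauss_term_telescopes lessThan_Suc_atMost)
  also have "\<dots> = gauss_certificate (Suc N) - gauss_certificate 0"
    by (rule sum_lessThan_telescope)
  finally show ?thesis by (simp add: gauss_certificate_def)
qed

lemma gauss_certificate_Suc: "\<exists>g. gauss_certificate (Suc N) = fps_X ^ (N + 2) * g"
  unfolding gauss_certificate_def gauss_term_def
  by (rule exI[of _ "4 * of_nat (Suc N) * lin 1 * lin 4 * fps_const (gauss_coeff (Suc N))
       * (\<Prod>k\<le>Suc N. inverse (lin (of_nat (4 * k + 1))))"])
    (simp only: mult_ac power_Suc add_2_eq_Suc')

lemma gauss_sum_nth_0: "gauss_sum N $ 0 = 1"
proof -
  have "gauss_term n $ 0 = (if n = 0 then 1 else 0)" for n
    by (simp add: gauss_term_def gauss_coeff_def)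
  then show ?thesis by (simp add: gauss_sum_def fps_sum_nth)
qed

text \<open>
  Write \<open>E\<close> for the exponential series and \<open>Q\<close> for the partial sum. The series \<open>(1 - X) Q\<close> satisfies
  the linear difference equation of \<open>E\<close> up to an error of order \<open>X\<^bsup>N+2\<^esup>\<close>. Hence the quotient \<open>u\<close> of the
  two is invariant under translation by 4 to this order, and so \<open>u = 1 + O(X\<^bsup>N+1\<^esup>)\<close>.
\<close>

lemma exp_B_nth_eq:
  assumes "k \<le> N"
  shows "exp_B $ k = (lin (- 1) * gauss_sum N) $ k"
proof -
  define f where "f = lin (- 1) * gauss_sum N"
  define u where "u = f * inverse exp_B"
  \<comment> \<open>The common denominator of the difference equations of \<open>f\<close> and of the exponential series.\<close>
  define D where "D = translate 4 exp_B * lin (- 1) * lin 3 * lin 4"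
  have f: "f = u * exp_B"
    unfolding u_def mult.assoc by (simp add: inverse_mult_eq_1 exp_B_nth_0)
  have D0: "D $ 0 = 1" by (simp add: D_def exp_B_nth_0)
  have "translate 4 f = lin 3 * inverse (lin 4) * translate 4 (gauss_sum N)"
    by (simp add: f_def translate_mult translate_lin)
  then have "translate 4 f * lin 4 = lin 3 * translate 4 (gauss_sum N) * (inverse (lin 4) * lin 4)"
    by (simp only: mult_ac)
  then have tf: "translate 4 f * lin 4 = lin 3 * translate 4 (gauss_sum N)"
    unfolding inverse_lin_mult by simp
  have "(translate 4 u - u) * D = (translate 4 u * translate 4 exp_B * lin 4) * lin (- 1) * lin 3
     - u * lin 4 * (lin (- 1) * lin 3 * translate 4 exp_B)"
    by (simp add: D_def algebra_simps)
  also have "\<dots> = translate 4 f * lin 4 * lin (- 1) * lin 3 - f * lin 4 * (lin 1)\<^sup>2"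
    unfolding exp_B_shift by (simp add: f translate_mult algebra_simps)
  also have "\<dots> = lin (- 1) * gauss_certificate (Suc N)"
    unfolding tf unfolding gauss_sum_shift[symmetric] f_def by (simp add: algebra_simps power2_eq_square)
  finally have *: "(translate 4 u - u) * D = lin (- 1) * gauss_certificate (Suc N)" .
  obtain g where g: "gauss_certificate (Suc N) = fps_X ^ (N + 2) * g"
    using gauss_certificate_Suc by blast
  have "translate 4 u - u = (translate 4 u - u) * D * inverse D"
    using D0 by (simp add: mult.assoc inverse_mult_eq_1')
  also have "\<dots> = fps_X ^ (N + 2) * (g * lin (- 1) * inverse D)"
    unfolding * g by (simp only: mult_ac)
  finally have shift: "translate 4 u - u = fps_X ^ (N + 2) * (g * lin (- 1) * inverse D)" .
  have "translate 4 u $ j = u $ j" if "j \<le> Suc N" for j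
  proof -
    have "(translate 4 u - u) $ j = 0"
      unfolding shift using that by (simp add: fps_X_power_mult_nth del: power_Suc)
    then show ?thesis by simp
  qed
  then have u: "u $ j = 0" if "1 \<le> j" "j \<le> N" for j
    using nth_eq_0_if_translate_invariant[of 4 N u] that by simp
  have "u $ 0 = 1" by (simp add: u_def f_def gauss_sum_nth_0 exp_B_nth_0)
  have "f $ k = (\<Sum>j\<in>{0..k}. u $ j * exp_B $ (k - j))"
    by (simp add: f fps_mult_nth)
  also have "\<dots> = (\<Sum>j\<in>{0}. u $ j * exp_B $ (k - j))"
    using u assms by (intro sum.mono_neutral_right) auto
  finally show ?thesis using \<open>u $ 0 = 1\<close> by (simp add: f_def)
qed

section \<open>The coefficients of the series\<close>

definition integer_coeffs :: "rat fps \<Rightarrow> bool" where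
  "integer_coeffs f \<longleftrightarrow> (\<forall>n. f $ n \<in> \<int>)"

lemma integer_coeffs_mult: "integer_coeffs f \<Longrightarrow> integer_coeffs g \<Longrightarrow> integer_coeffs (f * g)"
  by (auto simp: integer_coeffs_def fps_mult_nth intro!: Ints_sum Ints_mult)

lemma integer_coeffs_1: "integer_coeffs 1"
  by (simp add: integer_coeffs_def)

lemma integer_coeffs_inverse_lin:
  assumes "c \<in> \<int>"
  shows "integer_coeffs (inverse (lin c))"
proof -
  have "inverse (lin c) = inverse ((1 - fps_const (- c) * fps_X) ^ 1)"
    by (simp add: lin_def flip: fps_const_neg)
  also have "\<dots> = Abs_fps (\<lambda>k. (- c) ^ k)"
    by (subst one_minus_const_fps_X_neg_power') simp_all
  finally show ?thesis using assms by (simp add: integer_coeffs_def)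
qed

lemma integer_coeffs_prod:
  "(\<And>x. x \<in> A \<Longrightarrow> integer_coeffs (f x)) \<Longrightarrow> integer_coeffs (\<Prod>x\<in>A. f x)"
  by (induction A rule: infinite_finite_induct)
    (simp_all add: integer_coeffs_mult integer_coeffs_1)

lemma F_series_eq: "F_series = fps_to_fls (- 4 * fps_X\<^sup>2 * exp_B * inverse ((lin (- 1))\<^sup>2 * lin 1))"
proof -
  define W where "W = (lin (- 1))\<^sup>2 * (lin 1 :: rat fps)"
  define E where "E = fps_to_fls exp_B"
  have lm: "fps_to_fls (lin (- 1)) = fls_X * (Z - 1)"
   and lp: "fps_to_fls (lin 1) = fls_X * (Z + 1)"
    by (simp_all add: lin_def fls_times_fps_to_fls algebra_simps flip: fps_const_neg fls_inverse_X)
  have W: "fps_to_fls W = fls_X ^ 3 * ((Z - 1) ^ 2 * (Z + 1))"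
    by (simp add: W_def fls_times_fps_to_fls fps_to_fls_power lm lp power_mult_distrib
      power2_eq_square power3_eq_cube)
  have cancel: "- 4 * x\<^sup>2 * e / (x ^ 3 * d) = - (4 * inverse x * e / d)"
    if "x \<noteq> 0" "d \<noteq> 0" for x e d :: "rat fls"
    using that by (simp add: field_simps power2_eq_square power3_eq_cube)
  have W0: "W $ 0 = 1" by (simp add: W_def power2_eq_square)
  then have "W \<noteq> 0" by auto
  then have "fps_to_fls W \<noteq> 0" by simp
  with W have D0: "(Z - 1) ^ 2 * (Z + 1) \<noteq> 0" by auto
  have "fps_to_fls (inverse W) = inverse (fps_to_fls W)"
    by (rule fls_inverse_fps_to_fls[symmetric]) (simp add: W0)
  then have "fps_to_fls (- 4 * fps_X\<^sup>2 * exp_B * inverse W)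
      = - 4 * fls_X ^ 2 * E / (fls_X ^ 3 * ((Z - 1) ^ 2 * (Z + 1)))"
    by (simp add: fls_times_fps_to_fls fps_to_fls_power E_def W divide_inverse)
  also have "\<dots> = - (4 * inverse fls_X * E / ((Z - 1) ^ 2 * (Z + 1)))"
    by (rule cancel) (use D0 in simp_all)
  also have "\<dots> = F_series"
    by (simp add: F_series_def E_def exp_B_eq fls_inverse_X)
  finally show ?thesis by (simp add: W_def)
qed

text \<open>
  The factor \<open>1 - X\<close> of the hypergeometric expansion cancels one of the two factors \<open>1 - X\<close> in the
  denominator of the series. Because of the factor \<open>X\<^sup>2\<close>, the partial sum up to \<open>n = 2m\<close> suffices.
\<close>

lemma F_series_nth:
  "fls_nth F_series (2 * int m + 2)
    = - 4 * (gauss_sum (2 * m) * inverse (lin (- 1) * lin 1)) $ (2 * m)"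
proof -
  define W where "W = inverse (lin (- 1) * lin (1 :: rat))"
  have "fls_nth F_series (2 * int m + 2) =
     (- 4 * fps_X\<^sup>2 * exp_B * inverse ((lin (- 1))\<^sup>2 * lin 1)) $ (2 * m + 2)"
    unfolding F_series_eq by (simp add: nat_add_distrib nat_mult_distrib del: add_2_eq_Suc')
  also have "- 4 * fps_X\<^sup>2 * exp_B * inverse ((lin (- 1))\<^sup>2 * lin 1)
     = fps_X\<^sup>2 * (fps_const (- 4) * (exp_B * (inverse (lin (- 1)) * W)))"
    by (simp add: W_def power2_eq_square fps_inverse_mult mult_ac numeral_fps_const)
  also have "\<dots> $ (2 * m + 2) = - 4 * (exp_B * (inverse (lin (- 1)) * W)) $ (2 * m)"
    by (simp add: fps_X_power_mult_nth)
  also have "(exp_B * (inverse (lin (- 1)) * W)) $ (2 * m)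
     = (lin (- 1) * gauss_sum (2 * m) * (inverse (lin (- 1)) * W)) $ (2 * m)"
    unfolding fps_mult_nth by (intro sum.cong refl) (simp add: exp_B_nth_eq flip: fps_mult_nth)
  also have "lin (- 1) * gauss_sum (2 * m) * (inverse (lin (- 1)) * W)
     = gauss_sum (2 * m) * W * (inverse (lin (- 1)) * lin (- 1))"
    by (simp only: mult_ac)
  finally show ?thesis by (simp add: W_def)
qed

text \<open>
  The \<open>n\<close>-th summand contributes an integer multiple of \<open>((2n - 1)!!)\<^sup>2 / n!\<close>. Multiplied by \<open>(2m)!\<close>,
  the summand for \<open>n = 2m\<close> is the odd number \<open>((4m - 1)!!)\<^sup>2\<close>, whereas for \<open>n < 2m\<close> the quotient
  \<open>(2m)!/n!\<close> contains the even factor \<open>2m\<close>.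
\<close>

lemma fact_mult_F_series_nth:
  "\<exists>k. odd k \<and> fls_nth F_series (2 * int m + 2) * of_int (fact (2 * m)) = of_int (- 4 * k)"
proof -
  define w :: "nat \<Rightarrow> rat" where "w n =
      ((\<Prod>k\<le>n. inverse (lin (of_nat (4 * k + 1)))) * inverse (lin (- 1) * lin 1)) $ (2 * m - n)"
    for n
  define a where "a n = (\<Prod>j<n. 2 * int j + 1)\<^sup>2" for n
  have a: "of_int (a n) = (\<Prod>j<n. 1 + 2 * rat_of_nat j)\<^sup>2" for n
    by (simp add: a_def add.commute)
  have "w n \<in> \<int>" for n
  proof -
    have "integer_coeffs ((\<Prod>k\<le>n. inverse (lin (of_nat (4 * k + 1)))) * (inverse (lin (- 1)) * inverse (lin 1)))"
      by (intro integer_coeffs_mult integer_coeffs_prod integer_coeffs_inverse_lin) auto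
    then show ?thesis by (simp add: w_def integer_coeffs_def fps_inverse_mult)
  qed
  then have "\<exists>z. w n = of_int z" for n by (metis Ints_cases)
  then obtain z where z: "\<And>n. w n = of_int (z n)" by metis
  have w_top: "w (2 * m) = 1"
  proof -
    have "(\<Prod>k\<le>n. inverse (lin (of_nat (4 * k + 1) :: rat))) $ 0 = 1" for n
      by (induction n) simp_all
    then show ?thesis by (simp add: w_def)
  qed
  have "(gauss_sum (2 * m) * inverse (lin (- 1) * lin 1)) $ (2 * m)
     = (\<Sum>n\<le>2 * m. gauss_coeff n * w n)"
  proof -
    have "(gauss_term n * inverse (lin (- 1) * lin 1)) $ (2 * m) = gauss_coeff n * w n"
      if "n \<le> 2 * m" for n
    proof -
      have "gauss_term n * inverse (lin (- 1) * lin 1) = fps_X ^ n * (fps_const (gauss_coeff n) *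
         ((\<Prod>k\<le>n. inverse (lin (of_nat (4 * k + 1)))) * inverse (lin (- 1) * lin 1)))"
        unfolding gauss_term_def by (simp only: mult_ac)
      then show ?thesis
        using that by (simp only: fps_X_power_mult_nth fps_mult_left_const_nth w_def) simp
    qed
    then show ?thesis
      unfolding gauss_sum_def sum_distrib_right fps_sum_nth by (intro sum.cong refl) simp
  qed
  then have F: "fls_nth F_series (2 * int m + 2) = - 4 * (\<Sum>n\<le>2 * m. gauss_coeff n * w n)"
    by (simp add: F_series_nth)
  have "\<exists>c. fact (2 * m) * (gauss_coeff n * w n) = of_int (2 * c)" if "n < 2 * m" for n
  proof -
    from that have "fact n dvd (fact (2 * m - 1) :: int)" by (intro fact_dvd) auto
    then obtain d where d: "fact (2 * m - 1) = fact n * (d :: int)" by (elim dvdE)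
    have "fact (2 * m) = of_nat (2 * m) * (fact (2 * m - 1) :: int)"
      using that by (intro fact_reduce) auto
    then have "(of_int (fact (2 * m)) :: rat) = of_int (2 * (int m * (fact n * d)))"
      unfolding d by simp
    then have "fact (2 * m) * (gauss_coeff n * w n) = of_int (2 * (int m * d * a n * z n))"
      by (simp add: gauss_coeff_def z a)
    then show ?thesis by blast
  qed
  then obtain c where c: "\<And>n. n < 2 * m \<Longrightarrow> fact (2 * m) * (gauss_coeff n * w n) = of_int (2 * c n)"
    by metis
  define k where "k = a (2 * m) + 2 * (\<Sum>n<2 * m. c n)"
  have "odd k" by (auto simp: k_def a_def even_prod_iff)
  have "fact (2 * m) * (\<Sum>n\<le>2 * m. gauss_coeff n * w n)
     = (\<Sum>n<2 * m. fact (2 * m) * (gauss_coeff n * w n)) + fact (2 * m) * gauss_coeff (2 * m)"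
    by (simp add: w_top sum_distrib_left distrib_left flip: lessThan_Suc_atMost)
  also have "(\<Sum>n<2 * m. fact (2 * m) * (gauss_coeff n * w n)) = of_int (2 * (\<Sum>n<2 * m. c n))"
    by (simp add: c sum_distrib_left)
  also have "fact (2 * m) * gauss_coeff (2 * m) = of_int (a (2 * m))"
    by (simp add: gauss_coeff_def a)
  also have "of_int (2 * (\<Sum>n<2 * m. c n)) + of_int (a (2 * m)) = rat_of_int k"
    by (simp add: k_def)
  finally have S: "fact (2 * m) * (\<Sum>n\<le>2 * m. gauss_coeff n * w n) = of_int k" .
  have "fls_nth F_series (2 * int m + 2) * of_int (fact (2 * m)) = of_int (- 4 * k)"
    unfolding F of_int_mult S[symmetric] by (simp add: mult_ac)
  with \<open>odd k\<close> show ?thesis by blast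
qed

section \<open>Valuations\<close>

lemma multiplicity_fact_Suc:
  "multiplicity 2 (fact (Suc n) :: int) = multiplicity 2 (int (Suc n)) + multiplicity 2 (fact n :: int)"
  by (simp add: prime_elem_multiplicity_mult_distrib del: of_nat_Suc)

lemma multiplicity_2_odd: "odd (k :: int) \<Longrightarrow> multiplicity 2 k = 0"
  by (rule not_dvd_imp_multiplicity_0)

lemma multiplicity_2_double: "k \<noteq> 0 \<Longrightarrow> multiplicity 2 (2 * k :: int) = Suc (multiplicity 2 k)"
  by (simp add: multiplicity_times_same)

lemma multiplicity_fact_double: "multiplicity 2 (fact (2 * n) :: int) = n + multiplicity 2 (fact n :: int)"
proof (induction n)
  case (Suc n)
  have "multiplicity 2 (fact (2 * Suc n) :: int)
    = multiplicity 2 (int (Suc (Suc (2 * n)))) + (multiplicity 2 (int (Suc (2 * n))) + multiplicity 2 (fact (2 * n) :: int))"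
    by (simp only: multiplicity_fact_Suc mult_Suc_right add_2_eq_Suc)
  also have "multiplicity 2 (int (Suc (2 * n))) = 0"
    by (rule multiplicity_2_odd) simp
  also have "multiplicity 2 (int (Suc (Suc (2 * n)))) = Suc (multiplicity 2 (int (Suc n)))"
    using multiplicity_2_double[of "int (Suc n)"] by simp
  finally show ?case using Suc by (simp only: multiplicity_fact_Suc)
qed simp

text \<open>Legendre's formula for the prime 2.\<close>

lemma multiplicity_2_fact: "multiplicity 2 (fact n :: int) + binary_digit_sum n = n"
proof (induction n rule: less_induct)
  case (less n)
  consider "n = 0" | i where "n = 2 * i" "i > 0" | i where "n = Suc (2 * i)"
    by (metis oddE evenE Suc_eq_plus1 bot_nat_0.not_eq_extremum mult_0_right)
  then show ?case
  proof cases
    case 1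
    then show ?thesis by (simp add: binary_digit_sum.simps)
  next
    case 2
    then show ?thesis
      using less[of i] by (simp add: multiplicity_fact_double binary_digit_sum.simps[of "2 * i"])
  next
    case 3
    have "multiplicity 2 (fact n :: int) = multiplicity 2 (fact (2 * i) :: int)"
      unfolding 3 multiplicity_fact_Suc by (subst multiplicity_2_odd) simp_all
    then show ?thesis
      using 3 less[of i] by (simp add: multiplicity_fact_double binary_digit_sum.simps[of "Suc (2 * i)"])
  qed
qed

text \<open>The valuation can be read off from any representation as a fraction, reduced or not.\<close>

lemma nu2_eqI:
  assumes "q * of_int d = of_int a" "a \<noteq> 0" "d \<noteq> 0"
  shows "nu2 q = Fin (int (multiplicity 2 a) - int (multiplicity 2 d))"
proof -
  obtain x y where xy: "quotient_of q = (x, y)" by fastforce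
  have "y > 0" by (rule quotient_of_denom_pos[OF xy])
  have "q \<noteq> 0" using assms by auto
  have q: "q = of_int x / of_int y" by (rule quotient_of_div[OF xy])
  then have "rat_of_int x = q * of_int y" using \<open>y > 0\<close> by simp
  then have "of_int (x * d) = rat_of_int (a * y)"
    unfolding of_int_mult assms(1)[symmetric] by (simp only: mult_ac)
  then have e: "x * d = a * y" by (simp only: of_int_eq_iff)
  then have "x \<noteq> 0" using assms \<open>y > 0\<close> by auto
  have "multiplicity 2 (x * d) = multiplicity 2 (a * y)" by (simp add: e)
  then have "multiplicity 2 x + multiplicity 2 d = multiplicity 2 a + multiplicity 2 y"
    using assms \<open>y > 0\<close> \<open>x \<noteq> 0\<close> by (simp add: prime_elem_multiplicity_mult_distrib)
  then show ?thesis using \<open>q \<noteq> 0\<close> by (simp add: nu2_def xy)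
qed

theorem theorem7p41:
  fixes m :: nat
  shows "nu2 (fls_nth F_series (2 * int m + 2)) = Fin (2 - 2 * int m + int (binary_digit_sum m))"
proof -
  obtain k where "odd k"
    and k: "fls_nth F_series (2 * int m + 2) * of_int (fact (2 * m)) = of_int (- 4 * k)"
    using fact_mult_F_series_nth by blast
  have "k \<noteq> 0" using \<open>odd k\<close> by auto
  have "multiplicity 2 (- 4 * k) = multiplicity 2 (2 * (2 * - k))" by simp
  also have "\<dots> = 2"
    using \<open>k \<noteq> 0\<close> \<open>odd k\<close> by (subst multiplicity_2_double, simp)+ (simp add: multiplicity_2_odd)
  finally have "nu2 (fls_nth F_series (2 * int m + 2)) = Fin (2 - int (multiplicity 2 (fact (2 * m) :: int)))"
    using nu2_eqI[OF k] \<open>k \<noteq> 0\<close> by simp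
  moreover have "multiplicity 2 (fact (2 * m) :: int) + binary_digit_sum m = 2 * m"
    using multiplicity_2_fact[of m] by (simp add: multiplicity_fact_double)
  ultimately show ?thesis by simp
qed

end
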